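(* There exists a sequence $(a_n)_{n\ge 1}$ with $a_n\in\{0,+1,-1\}$ for every $n$ such that the Dirichlet series $\sum_{n=1}^{\infty} a_n/n^s$ has both of the following properties: (i) for every real $\delta>0$, the series converges uniformly on the closed half-plane $\{s\in\mathbb{C} : \operatorname{Re} s\ge \delta+\tfrac12\}$; (ii) for every $s\in\mathbb{C}$ with $\operatorname{Re} s<1$, the series does not converge absolutely, that is, $\sum_{n=1}^{\infty}|a_n/n^s|=\infty$.
   Context: An (ordinary) Dirichlet series is a series $\sum_{n=1}^{\infty} a_n/n^s$ with complex constants $a_n$ and complex variable $s$, where $n^s=e^{s\log n}$ with $\log n$ real. Uniform convergence on a set means uniform convergence on that set of the partial sums $\sum_{n=1}^{N} a_n/n^s$, taken in the natural order of $n$ (without grouping of terms), as $N\to\infty$. *)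

theory Defs
  imports "HOL-Analysis.Analysis"
begin

(* For n >= 1 the library's of_nat n powr s is exp (s * Ln (of_nat n)) with Ln (of_nat n) real. *)
definition dirichlet_term :: "(nat \<Rightarrow> complex) \<Rightarrow> complex \<Rightarrow> nat \<Rightarrow> complex" where
  "dirichlet_term a s n = a n / (of_nat n powr s)"

definition dirichlet_partial_sum :: "(nat \<Rightarrow> complex) \<Rightarrow> nat \<Rightarrow> complex \<Rightarrow> complex" where
  "dirichlet_partial_sum a N s = (\<Sum>n=1..N. dirichlet_term a s n)"

end

theory Submission
  imports Defs "HOL-Real_Asymp.Real_Asymp"
begin

text \<open>
The coefficients are built in finite blocks with disjoint, increasing supports. A block is given by a
quality \<open>m\<close>, a large \<open>Y\<close> and \<open>l = 2 * m\<close>: its support is the set \<open>S\<close> of all products of \<open>l\<close> numbers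
from \<open>(Y, 2 * Y]\<close> that have at most \<open>4 * (1 + ln (2 * Y))\<close> divisors each. Put \<open>N = (2 * Y) ^ l\<close>.

The set \<open>S\<close> is large. At least half of the numbers in \<open>(Y, 2 * Y]\<close> are admitted as factors, because the
divisor function is logarithmic on average, and each product has only polylogarithmically many
factorizations of this kind, so \<open>S\<close> has at least \<open>N powr (1 - 1 / m)\<close> elements
(\<open>card_few_divisors_ge\<close>, \<open>card_products_ge\<close>). Hence the sum of \<open>n powr (1 / m - 1)\<close> over \<open>S\<close> is at
least 1, which forces the divergence of the absolute series for \<open>Re s < 1\<close>.

The set \<open>S\<close> has few degrees of freedom. On \<open>S\<close> the function \<open>n \<mapsto> cis (t ln n)\<close> is determined by at
most \<open>Y\<close> phases, so that up to a negligible rounding error only \<open>exp (O (Y ln Y))\<close> such functions occur as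
\<open>t\<close> varies. A greedy choice of signs, made to control a sum of hyperbolic cosines
(\<open>sign_choice_cosh_potential\<close>), keeps all partial sums of the signed series over \<open>S\<close> below a constant
times \<open>sqrt N * Y ln Y\<close> for all these functions at once (\<open>signs_for_products\<close>). As \<open>Y\<close> is about
\<open>N powr (1 / (2 * m))\<close>, Abel's inequality yields partial sums of norm at most \<open>1 / 2 ^ m\<close> on the half-plane
\<open>Re s \<ge> 1/2 + 1 / m\<close> (\<open>dirichlet_block_exists\<close>). Concatenating blocks of quality 1, 2, 3 and so on
gives the series: for fixed \<open>\<delta>\<close> all but finitely many blocks are controlled on the half-plane
\<open>Re s \<ge> \<delta> + 1/2\<close> by a geometric series.
\<close>

section \<open>Greedy choice of signs\<close>

lemma cosh_le_exp_half_square: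
  fixes x :: real
  shows "cosh x \<le> exp (x\<^sup>2 / 2)"
proof -
  have "(\<lambda>n. if even n then x ^ n /\<^sub>R fact n else 0) sums cosh x"
    using cosh_converges[of x] by simp
  hence *: "(\<lambda>n. x ^ (2*n) /\<^sub>R fact (2*n)) sums cosh x"
    by (subst (asm) sums_mono_reindex[of "\<lambda>n. 2*n", symmetric])
       (auto simp: strict_mono_def image_iff elim!: evenE)
  have **: "(\<lambda>n. (x\<^sup>2/2) ^ n /\<^sub>R fact n) sums exp (x\<^sup>2/2)"
    by (rule exp_converges)
  have fact: "2 ^ n * fact n \<le> (fact (2*n) :: real)" for n
  proof (induction n)
    case (Suc n)
    have "2 ^ Suc n * fact (Suc n) = (2 ^ n * fact n) * (2 * real (Suc n))"
      by (simp add: field_simps)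
    also have "\<dots> \<le> fact (2*n) * ((2 * real n + 2) * (2 * real n + 1))"
      by (intro mult_mono Suc) (auto simp: field_simps)
    also have "\<dots> = fact (2 * Suc n)" by (simp add: field_simps)
    finally show ?case .
  qed auto
  show ?thesis
  proof (rule sums_le[OF _ * **])
    fix n
    have "x ^ (2*n) / fact (2*n) \<le> x ^ (2*n) / (2 ^ n * fact n)"
      by (intro divide_left_mono fact) (auto simp: power_mult)
    also have "\<dots> = (x\<^sup>2/2) ^ n / fact n"
      by (simp add: power_mult power_divide)
    finally show "x ^ (2*n) /\<^sub>R fact (2*n) \<le> (x\<^sup>2/2) ^ n /\<^sub>R fact n"
      by (simp only: real_scaleR_def divide_inverse_commute)
  qed
qed

text \<open>
The signs are chosen one after another: the mean of the potential over the two choices of the next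
sign is at most \<open>exp (r\<^sup>2 / 2)\<close> times its current value, because
\<open>cosh (u + v) + cosh (u - v) = 2 cosh u cosh v\<close>, so one of the two choices does not exceed the mean.
A greedy choice, unlike a random one, keeps the bound at every intermediate length \<open>x\<close> at no extra
cost.
\<close>

lemma sign_choice_cosh_potential:
  fixes c :: "nat \<Rightarrow> 'j \<Rightarrow> real" and r :: real
  assumes "\<And>n j. \<bar>c n j\<bar> \<le> 1"
  shows "\<exists>e::nat\<Rightarrow>real. (\<forall>n. e n \<in> {1, -1}) \<and>
           (\<forall>x\<le>X. (\<Sum>j\<in>J. cosh (r * (\<Sum>n<x. e n * c n j))) \<le> real (card J) * exp (r\<^sup>2 / 2 * real x))"
proof (induction X)
  case 0
  show ?case by (intro exI[of _ "\<lambda>_. 1"]) auto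
next
  case (Suc X)
  then obtain e :: "nat \<Rightarrow> real" where e: "\<forall>n. e n \<in> {1, -1}"
    and "\<forall>x\<le>X. (\<Sum>j\<in>J. cosh (r * (\<Sum>n<x. e n * c n j))) \<le> real (card J) * exp (r\<^sup>2 / 2 * real x)"
    by (elim exE conjE)
  hence le: "(\<Sum>j\<in>J. cosh (r * (\<Sum>n<x. e n * c n j))) \<le> real (card J) * exp (r\<^sup>2 / 2 * real x)"
    if "x \<le> X" for x
    using that by simp
  define T where "T j = r * (\<Sum>n<X. e n * c n j)" for j
  define B where "B = real (card J) * exp (r\<^sup>2 / 2 * real (Suc X))"
  have avg: "(\<Sum>j\<in>J. cosh (T j + r * c X j)) + (\<Sum>j\<in>J. cosh (T j - r * c X j)) \<le> 2 * B"
  proof -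
    have "(\<Sum>j\<in>J. cosh (T j + r * c X j)) + (\<Sum>j\<in>J. cosh (T j - r * c X j))
        = (\<Sum>j\<in>J. 2 * (cosh (T j) * cosh (r * c X j)))"
      unfolding sum.distrib[symmetric] by (intro sum.cong refl) (simp add: cosh_add cosh_diff)
    also have "\<dots> = 2 * (\<Sum>j\<in>J. cosh (T j) * cosh (r * c X j))"
      by (rule sum_distrib_left[symmetric])
    also have "\<dots> \<le> 2 * (\<Sum>j\<in>J. cosh (T j) * exp (r\<^sup>2 / 2))"
    proof (intro mult_left_mono sum_mono)
      fix j
      have "(c X j)\<^sup>2 \<le> 1" using assms[of X j] by (simp add: abs_square_le_1)
      hence "(r * c X j)\<^sup>2 / 2 \<le> r\<^sup>2 / 2"
        by (simp add: power_mult_distrib mult_left_le)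
      thus "cosh (r * c X j) \<le> exp (r\<^sup>2 / 2)"
        using cosh_le_exp_half_square[of "r * c X j"] by (meson exp_le_cancel_iff order_trans)
    qed auto
    also have "\<dots> = 2 * (exp (r\<^sup>2 / 2) * (\<Sum>j\<in>J. cosh (T j)))"
      unfolding sum_distrib_right[symmetric] by (simp only: mult.commute)
    also have "\<dots> \<le> 2 * (exp (r\<^sup>2 / 2) * (real (card J) * exp (r\<^sup>2 / 2 * real X)))"
      using le[of X] by (auto simp: T_def)
    also have "\<dots> = 2 * B"
    proof -
      have "exp (r\<^sup>2 / 2) * exp (r\<^sup>2 / 2 * real X) = exp (r\<^sup>2 / 2 * real (Suc X))"
        unfolding exp_add[symmetric] by (simp add: distrib_left)
      thus ?thesis by (simp add: B_def mult_ac)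
    qed
    finally show ?thesis .
  qed
  obtain u :: real where u: "u \<in> {1, -1}" and uB: "(\<Sum>j\<in>J. cosh (T j + r * (u * c X j))) \<le> B"
  proof (cases "(\<Sum>j\<in>J. cosh (T j + r * c X j)) \<le> B")
    case True thus ?thesis using that[of 1] by simp
  next
    case False thus ?thesis using that[of "-1"] avg by simp
  qed
  have eq: "(\<Sum>n<x. (e(X := u)) n * c n j) = (\<Sum>n<x. e n * c n j)" if "x \<le> X" for x j
    using that by (intro sum.cong) auto
  have "(\<Sum>j\<in>J. cosh (r * (\<Sum>n<x. (e(X := u)) n * c n j))) \<le> real (card J) * exp (r\<^sup>2 / 2 * real x)"
    if "x \<le> Suc X" for x
  proof (cases "x = Suc X")
    case True
    have "(\<Sum>n<x. (e(X := u)) n * c n j) = (\<Sum>n<X. e n * c n j) + u * c X j" for j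
      using eq[of X j] True by simp
    thus ?thesis using uB True by (simp add: T_def B_def distrib_left)
  next
    case False
    hence "x \<le> X" using that by simp
    show ?thesis unfolding eq[OF \<open>x \<le> X\<close>] by (rule le[OF \<open>x \<le> X\<close>])
  qed
  moreover have "(e(X := u)) n \<in> {1, -1}" for n
    using e u by (simp del: insert_iff)
  ultimately show ?case by (intro exI[of _ "e(X := u)"]) (intro conjI allI impI)
qed

lemma sign_choice_partial_sums:
  fixes c :: "nat \<Rightarrow> 'j \<Rightarrow> real" and r :: real
  assumes c: "\<And>n j. \<bar>c n j\<bar> \<le> 1" and J: "finite J" and r: "r > 0"
  shows "\<exists>e::nat\<Rightarrow>real. (\<forall>n. e n \<in> {1, -1}) \<and>
           (\<forall>x\<le>X. \<forall>j\<in>J. \<bar>\<Sum>n<x. e n * c n j\<bar> \<le> ln (2 * real (card J)) / r + r * real X / 2)"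
proof -
  obtain e :: "nat \<Rightarrow> real" where e: "\<forall>n. e n \<in> {1, -1}"
    and le: "\<forall>x\<le>X. (\<Sum>j\<in>J. cosh (r * (\<Sum>n<x. e n * c n j))) \<le> real (card J) * exp (r\<^sup>2 / 2 * real x)"
    using sign_choice_cosh_potential[where c = c and X = X and J = J and r = r, OF c] by (elim exE conjE)
  have "\<bar>\<Sum>n<x. e n * c n j\<bar> \<le> ln (2 * real (card J)) / r + r * real X / 2"
    if x: "x \<le> X" and j: "j \<in> J" for x j
  proof -
    define T where "T = (\<Sum>n<x. e n * c n j)"
    have cJ: "real (card J) > 0" using j J by (auto simp: card_gt_0_iff)
    have "exp (r * \<bar>T\<bar>) / 2 \<le> cosh (r * \<bar>T\<bar>)"
      by (simp add: cosh_field_def)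
    also have "\<dots> = cosh (r * T)" by (cases "T \<ge> 0") auto
    also have "\<dots> \<le> (\<Sum>j\<in>J. cosh (r * (\<Sum>n<x. e n * c n j)))"
      unfolding T_def by (rule member_le_sum[OF j]) (auto simp: J)
    also have "\<dots> \<le> real (card J) * exp (r\<^sup>2 / 2 * real x)" using le x by blast
    also have "\<dots> \<le> real (card J) * exp (r\<^sup>2 / 2 * real X)"
      using x by (intro mult_left_mono) (auto intro!: mult_left_mono)
    finally have "exp (r * \<bar>T\<bar>) \<le> 2 * real (card J) * exp (r\<^sup>2 / 2 * real X)" by simp
    also have "\<dots> = exp (ln (2 * real (card J)) + r\<^sup>2 / 2 * real X)"
      using cJ by (simp add: exp_add)
    finally have "r * \<bar>T\<bar> \<le> ln (2 * real (card J)) + r\<^sup>2 / 2 * real X" by simp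
    thus ?thesis using r by (simp add: T_def field_simps power2_eq_square)
  qed
  with e show ?thesis by (intro exI[of _ e]) simp
qed

section \<open>Signs for sums of characters over products\<close>

lemma norm_cis_diff_le: "norm (cis a - cis b) \<le> \<bar>a - b\<bar>"
proof -
  have "norm (cis a - cis b) = norm (cis b * (cis (a - b) - 1))"
    by (simp add: right_diff_distrib cis_mult)
  also have "\<dots> = norm (exp (\<i> * of_real (a - b)) - 1)"
    by (simp add: norm_mult cis_conv_exp)
  also have "\<dots> \<le> \<bar>a - b\<bar>"
    unfolding dist_exp_i_1 using abs_sin_x_le_abs_x[of "(a - b) / 2"] by simp
  finally show ?thesis .
qed

lemma norm_cis_sum_list_diff_le:
  assumes "\<And>b. b \<in> set bs \<Longrightarrow> norm (cis (f b) - cis (g b)) \<le> \<epsilon>"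
  shows "norm (cis (\<Sum>b\<leftarrow>bs. f b) - cis (\<Sum>b\<leftarrow>bs. g b)) \<le> real (length bs) * \<epsilon>"
  using assms
proof (induction bs)
  case (Cons b bs)
  define u v where "u = (\<Sum>b\<leftarrow>bs. f b)" and "v = (\<Sum>b\<leftarrow>bs. g b)"
  have "cis (f b + u) - cis (g b + v) = cis (f b) * (cis u - cis v) + (cis (f b) - cis (g b)) * cis v"
    by (simp add: cis_mult[symmetric] algebra_simps)
  also have "norm \<dots> \<le> norm (cis (f b) * (cis u - cis v)) + norm ((cis (f b) - cis (g b)) * cis v)"
    by (rule norm_triangle_ineq)
  also have "\<dots> = norm (cis u - cis v) + norm (cis (f b) - cis (g b))"
    by (simp add: norm_mult)
  also have "\<dots> \<le> real (length bs) * \<epsilon> + \<epsilon>"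
    using Cons unfolding u_def v_def by (intro add_mono) auto
  finally show ?case by (simp add: u_def v_def algebra_simps)
qed simp

lemma ln_prod_list_nat:
  assumes "\<And>b. b \<in> set bs \<Longrightarrow> b > (0::nat)"
  shows "ln (real (prod_list bs)) = (\<Sum>b\<leftarrow>bs. ln (real b))"
  using assms
proof (induction bs)
  case (Cons b bs)
  have "prod_list bs > 0" using Cons.prems by (intro Nat.gr0I) (auto simp: prod_list_zero_iff)
  thus ?case using Cons by (simp add: ln_mult)
qed simp

text \<open>
The function \<open>n \<mapsto> cis (t ln n)\<close> on products of \<open>l\<close> elements of \<open>G\<close> is determined by the \<open>card G\<close>
phases \<open>t ln b\<close>. Rounding each of them down to a multiple of \<open>2 pi / q\<close> moves every value by at most
\<open>2 pi l / q\<close> and leaves only \<open>q ^ card G\<close> functions to control, whatever the real number \<open>t\<close>. Their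
number enters the bound through its logarithm, of size \<open>card G * ln q\<close>.
\<close>

lemma signs_for_products:
  fixes S G :: "nat set" and l X :: nat
  assumes G: "finite G" "\<And>b. b \<in> G \<Longrightarrow> b > 0"
    and S: "\<And>n. n \<in> S \<Longrightarrow> \<exists>bs. length bs = l \<and> set bs \<subseteq> G \<and> n = prod_list bs"
    and l: "l \<ge> 1" and X: "X \<ge> 1"
  shows "\<exists>e::nat \<Rightarrow> real. (\<forall>n. e n \<in> {1, -1}) \<and>
           (\<forall>x\<le>X. \<forall>t. norm (\<Sum>n<x. if n \<in> S then e n *\<^sub>R cis (t * ln (real n)) else 0)
              \<le> 2 * sqrt (real X) * (3 + real (card G) * ln (8 * real l * real X)) + 1)"
proof -
  have "\<exists>fac. \<forall>n\<in>S. length (fac n) = l \<and> set (fac n) \<subseteq> G \<and> n = prod_list (fac n)"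
    using S by (intro bchoice ballI)
  then obtain fac where fac: "\<And>n. n \<in> S \<Longrightarrow> length (fac n) = l"
      "\<And>n. n \<in> S \<Longrightarrow> set (fac n) \<subseteq> G" "\<And>n. n \<in> S \<Longrightarrow> n = prod_list (fac n)"
    by metis
  \<comment> \<open>As \<open>2 pi < 8\<close>, this \<open>q\<close> makes the rounding errors of \<open>X\<close> terms add up to at most 1.\<close>
  define q where "q = 8 * l * X"
  have q: "q > 0" using l X by (simp add: q_def)
  define \<theta> :: "(nat \<Rightarrow> nat) \<Rightarrow> nat \<Rightarrow> real"
    where "\<theta> \<phi> n = (\<Sum>b\<leftarrow>fac n. 2 * pi * real (\<phi> b) / real q)" for \<phi> n
  \<comment> \<open>The shifts \<open>0\<close> and \<open>pi / 2\<close> give the real and the imaginary part of \<open>cis (\<theta> \<phi> n)\<close>.\<close>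
  define c where "c n p = (if n \<in> S then cos (\<theta> (fst p) n - snd p) else 0)" for n and p :: "(nat \<Rightarrow> nat) \<times> real"
  define J where "J = (G \<rightarrow>\<^sub>E {..<q}) \<times> {0, pi / 2}"
  \<comment> \<open>This \<open>r\<close> makes \<open>1 / r\<close> and \<open>r * X\<close> both equal to \<open>sqrt X\<close>.\<close>
  define r where "r = 1 / sqrt (real X)"
  have r: "r > 0" using X by (simp add: r_def)
  have J: "finite J" unfolding J_def by (intro finite_cartesian_product finite_PiE G) auto
  have cardJ: "card J = q ^ card G * 2"
    using G unfolding J_def by (simp add: card_cartesian_product card_PiE)
  have c: "\<bar>c n p\<bar> \<le> 1" for n p by (simp add: c_def)
  obtain e :: "nat \<Rightarrow> real" where e: "\<forall>n. e n \<in> {1, -1}"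
    and le: "\<forall>x\<le>X. \<forall>j\<in>J. \<bar>\<Sum>n<x. e n * c n j\<bar> \<le> ln (2 * real (card J)) / r + r * real X / 2"
    using sign_choice_partial_sums[where c = c and X = X, OF c J r] by (elim exE conjE)
  define B where "B = sqrt (real X) * (3 + real (card G) * ln (8 * real l * real X))"
  have B: "ln (2 * real (card J)) / r + r * real X / 2 \<le> B"
  proof -
    have "ln (2 * real (card J)) = ln (2 * (2 * real q ^ card G))" by (simp add: cardJ mult_ac)
    also have "\<dots> = ln 2 + ln (2 * real q ^ card G)"
      by (rule ln_mult_pos) (use q in auto)
    also have "ln (2 * real q ^ card G) = ln 2 + real (card G) * ln (real q)"
      using q by (simp add: ln_mult_pos ln_realpow)
    also have "ln 2 + (ln 2 + real (card G) * ln (real q)) \<le> 2 + real (card G) * ln (real q)"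
      using ln_2_less_1 by linarith
    also have "\<dots> = 2 + real (card G) * ln (8 * real l * real X)" by (simp add: q_def)
    finally have "sqrt (real X) * ln (2 * real (card J)) \<le> sqrt (real X) * (2 + real (card G) * ln (8 * real l * real X))"
      by (intro mult_left_mono) auto
    moreover have "ln (2 * real (card J)) / r = sqrt (real X) * ln (2 * real (card J))"
      by (simp add: r_def)
    moreover have "r * real X / 2 \<le> sqrt (real X)"
      by (simp add: r_def real_div_sqrt)
    ultimately show ?thesis by (simp add: B_def algebra_simps)
  qed
  have "norm (\<Sum>n<x. if n \<in> S then e n *\<^sub>R cis (t * ln (real n)) else 0) \<le> 2 * B + 1"
    if x: "x \<le> X" for x t
  proof -
    define \<phi> where "\<phi> = (\<lambda>b\<in>G. nat \<lfloor>real q * frac (t * ln (real b) / (2 * pi))\<rfloor>)"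
    have \<phi>: "\<phi> \<in> G \<rightarrow>\<^sub>E {..<q}"
    proof (unfold \<phi>_def, intro restrict_PiE_iff[THEN iffD2] ballI)
      fix b assume "b \<in> G"
      have "real q * frac (t * ln (real b) / (2 * pi)) < real q * 1"
        using q by (intro mult_strict_left_mono frac_lt_1) auto
      hence "\<lfloor>real q * frac (t * ln (real b) / (2 * pi))\<rfloor> < int q" by (simp add: floor_less_iff)
      thus "nat \<lfloor>real q * frac (t * ln (real b) / (2 * pi))\<rfloor> \<in> {..<q}"
        using q by simp
    qed
    have near: "norm (cis (t * ln (real b)) - cis (2 * pi * real (\<phi> b) / real q)) \<le> 2 * pi / real q"
      if b: "b \<in> G" for b
    proof -
      define z where "z = t * ln (real b) / (2 * pi)"
      have "t * ln (real b) = 2 * pi * frac z + 2 * pi * of_int \<lfloor>z\<rfloor>"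
        by (simp add: frac_def z_def field_simps)
      hence "cis (t * ln (real b)) = cis (2 * pi * frac z) * cis (2 * pi * of_int \<lfloor>z\<rfloor>)"
        by (simp only: cis_mult)
      also have "cis (2 * pi * of_int \<lfloor>z\<rfloor>) = 1" by simp
      finally have "norm (cis (t * ln (real b)) - cis (2 * pi * real (\<phi> b) / real q))
          \<le> \<bar>2 * pi * frac z - 2 * pi * real (\<phi> b) / real q\<bar>"
        using norm_cis_diff_le by simp
      also have "2 * pi * frac z - 2 * pi * real (\<phi> b) / real q = 2 * pi / real q * (real q * frac z - real (\<phi> b))"
        using q by (simp add: field_simps)
      also have "\<bar>\<dots>\<bar> \<le> 2 * pi / real q * 1"
      proof -
        have "real (\<phi> b) = of_int \<lfloor>real q * frac z\<rfloor>"
          using b by (simp add: \<phi>_def z_def)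
        hence "\<bar>real q * frac z - real (\<phi> b)\<bar> \<le> 1"
          by linarith
        thus ?thesis unfolding abs_mult by (intro mult_mono) auto
      qed
      finally show ?thesis by simp
    qed
    have near': "norm (cis (t * ln (real n)) - cis (\<theta> \<phi> n)) \<le> 1 / real X" if n: "n \<in> S" for n
    proof -
      have "ln (real n) = (\<Sum>b\<leftarrow>fac n. ln (real b))"
        using fac[OF n] G ln_prod_list_nat[of "fac n"] by auto
      hence "cis (t * ln (real n)) = cis (\<Sum>b\<leftarrow>fac n. t * ln (real b))"
        by (simp add: sum_list_const_mult)
      moreover have "norm (cis (\<Sum>b\<leftarrow>fac n. t * ln (real b)) - cis (\<theta> \<phi> n)) \<le> real (length (fac n)) * (2 * pi / real q)"
        unfolding \<theta>_def by (rule norm_cis_sum_list_diff_le, rule near) (use fac(2)[OF n] in blast)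
      ultimately have "norm (cis (t * ln (real n)) - cis (\<theta> \<phi> n)) \<le> real (length (fac n)) * (2 * pi / real q)"
        by simp
      also have "\<dots> = 2 * pi / 8 * (1 / real X)"
        using l X fac(1)[OF n] by (simp add: q_def)
      also have "\<dots> \<le> 1 * (1 / real X)"
        using pi_less_4 by (intro mult_right_mono) auto
      finally show ?thesis by simp
    qed
    define Z where "Z = (\<Sum>n<x. if n \<in> S then e n *\<^sub>R cis (\<theta> \<phi> n) else 0)"
    have "Re Z = (\<Sum>n<x. e n * c n (\<phi>, 0))"
      unfolding Z_def Re_sum by (intro sum.cong) (auto simp: c_def)
    also have "\<bar>\<dots>\<bar> \<le> B" using le x \<phi> B by (force simp: J_def)
    finally have Re: "\<bar>Re Z\<bar> \<le> B" .
    have "Im Z = (\<Sum>n<x. e n * c n (\<phi>, pi / 2))"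
      unfolding Z_def Im_sum by (intro sum.cong) (auto simp: c_def cos_diff)
    also have "\<bar>\<dots>\<bar> \<le> B" using le x \<phi> B by (force simp: J_def)
    finally have Im: "\<bar>Im Z\<bar> \<le> B" .
    have "norm ((\<Sum>n<x. if n \<in> S then e n *\<^sub>R cis (t * ln (real n)) else 0) - Z)
        = norm (\<Sum>n<x. if n \<in> S then e n *\<^sub>R (cis (t * ln (real n)) - cis (\<theta> \<phi> n)) else 0)"
      unfolding Z_def sum_subtractf[symmetric]
      by (intro arg_cong[of _ _ norm] sum.cong) (auto simp: scaleR_diff_right)
    also have "\<dots> \<le> (\<Sum>n<x. 1 / real X)"
    proof (rule sum_norm_le)
      fix n
      have "\<bar>e n\<bar> = 1" using e by (metis abs_1 abs_minus insert_iff empty_iff)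
      thus "norm (if n \<in> S then e n *\<^sub>R (cis (t * ln (real n)) - cis (\<theta> \<phi> n)) else 0) \<le> 1 / real X"
        using near'[of n] by simp
    qed
    also have "\<dots> \<le> 1" using x X by (simp add: field_simps)
    finally have diff: "norm ((\<Sum>n<x. if n \<in> S then e n *\<^sub>R cis (t * ln (real n)) else 0) - Z) \<le> 1" .
    have "norm Z \<le> 2 * B" using cmod_le[of Z] Re Im by linarith
    thus ?thesis using diff norm_triangle_sub[of "\<Sum>n<x. if n \<in> S then e n *\<^sub>R cis (t * ln (real n)) else 0" Z]
      by linarith
  qed
  thus ?thesis using e by (intro exI[of _ e]) (simp add: B_def mult.assoc)
qed

section \<open>Products of numbers with few divisors\<close>

lemma card_divisors_mult_le:
  assumes "a > (0::nat)" "b > 0"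
  shows "card {k. k dvd a * b} \<le> card {k. k dvd a} * card {k. k dvd b}"
proof -
  have "{k. k dvd a * b} \<subseteq> (\<lambda>(x, y). x * y) ` ({k. k dvd a} \<times> {k. k dvd b})"
  proof
    fix k assume "k \<in> {k. k dvd a * b}"
    then obtain x y where "k = x * y" "x dvd a" "y dvd b"
      using division_decomp[of k a b] by blast
    thus "k \<in> (\<lambda>(x, y). x * y) ` ({k. k dvd a} \<times> {k. k dvd b})" by blast
  qed
  hence "card {k. k dvd a * b} \<le> card ({k. k dvd a} \<times> {k. k dvd b})"
    by (rule surj_card_le[rotated]) (use assms in simp)
  thus ?thesis by (simp add: card_cartesian_product)
qed

lemma card_divisors_prod_list_le:
  assumes "\<And>b. b \<in> set bs \<Longrightarrow> b > 0 \<and> real (card {k. k dvd b}) \<le> D"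
  shows "real (card {k. k dvd (prod_list bs :: nat)}) \<le> D ^ length bs"
  using assms
proof (induction bs)
  case (Cons b bs)
  have pos: "prod_list bs > 0" using Cons.prems by (intro Nat.gr0I) (auto simp: prod_list_zero_iff)
  have "real (card {k. k dvd b * prod_list bs}) \<le> real (card {k. k dvd b} * card {k. k dvd prod_list bs})"
    using card_divisors_mult_le[OF _ pos, of b] Cons.prems by (intro of_nat_mono) auto
  also have "\<dots> \<le> D * D ^ length bs"
    unfolding of_nat_mult using Cons.prems[of b]
    by (intro mult_mono Cons) (auto intro: order_trans[of 0 "real (card {k. k dvd b})"] Cons.prems)
  finally show ?case by simp
qed simp

lemma sum_card_divisors_le:
  assumes "M \<ge> 1"
  shows "(\<Sum>b=1..M. real (card {k. k dvd b})) \<le> real M * (1 + ln (real M))"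
proof -
  have "(\<Sum>b=1..M. card {k. k dvd b}) = (\<Sum>b=1..M. \<Sum>k=1..M. if k dvd b then 1 else 0)"
  proof (intro sum.cong refl)
    fix b assume b: "b \<in> {1..M}"
    have "{k. k dvd b} = {k \<in> {1..M}. k dvd b}"
      using b by (auto dest: dvd_imp_le intro: Nat.gr0I)
    thus "card {k. k dvd b} = (\<Sum>k=1..M. if k dvd b then 1 else 0)"
      by (simp add: sum.If_cases Int_def cong: conj_cong)
  qed
  also have "\<dots> = (\<Sum>k=1..M. \<Sum>b=1..M. if k dvd b then 1 else 0)"
    by (rule sum.swap)
  also have "\<dots> = (\<Sum>k=1..M. card {b \<in> {1..M}. k dvd b})"
    by (simp add: sum.If_cases Int_def)
  also have "real \<dots> \<le> (\<Sum>k=1..M. real M * inverse (real k))"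
    unfolding of_nat_sum
  proof (rule sum_mono)
    fix k assume k: "k \<in> {1..M}"
    have "{b \<in> {1..M}. k dvd b} \<subseteq> (\<lambda>i. k * i) ` {1..M div k}"
    proof
      fix b assume b: "b \<in> {b \<in> {1..M}. k dvd b}"
      then obtain i where i: "b = k * i" by auto
      with b k have "i \<ge> 1" "i \<le> M div k"
        by (auto simp: less_eq_div_iff_mult_less_eq mult.commute Suc_le_eq intro: Nat.gr0I)
      with i show "b \<in> (\<lambda>i. k * i) ` {1..M div k}" by auto
    qed
    hence "card {b \<in> {1..M}. k dvd b} \<le> card {1..M div k}"
      by (rule surj_card_le[rotated]) simp
    hence "real (card {b \<in> {1..M}. k dvd b}) \<le> real (M div k)" by simp
    also have "\<dots> \<le> real M / real k" by (rule of_nat_div_le_of_nat)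
    finally show "real (card {b \<in> {1..M}. k dvd b}) \<le> real M * inverse (real k)"
      by (simp add: divide_inverse)
  qed
  also have "\<dots> = real M * harm M" by (simp add: harm_def sum_distrib_left)
  also have "\<dots> \<le> real M * (1 + ln (real M))"
    using euler_mascheroni_sequence_decreasing[of 1 M] assms
    by (intro mult_left_mono) (auto simp: harm_def)
  finally show ?thesis by simp
qed

text \<open>
Markov's inequality for the divisor function: a number up to \<open>2 * Y\<close> has at most \<open>1 + ln (2 * Y)\<close>
divisors on average.
\<close>

lemma card_few_divisors_ge:
  assumes "Y \<ge> 1"
  shows "real Y / 2 \<le> real (card {b \<in> {Y<..2*Y}. real (card {k. k dvd b}) \<le> 4 * (1 + ln (2 * real Y))})"
proof -
  define D where "D = 4 * (1 + ln (2 * real Y))"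
  define A B where "A = {b \<in> {Y<..2*Y}. real (card {k. k dvd b}) \<le> D}"
    and "B = {b \<in> {Y<..2*Y}. real (card {k. k dvd b}) > D}"
  have D: "D > 0" using assms by (auto simp: D_def intro!: add_pos_nonneg)
  have "real (card B) * D = (\<Sum>b\<in>B. D)" by simp
  also have "\<dots> \<le> (\<Sum>b\<in>B. real (card {k. k dvd b}))"
    by (rule sum_mono) (auto simp: B_def)
  also have "\<dots> \<le> (\<Sum>b=1..2*Y. real (card {k. k dvd b}))"
    by (rule sum_mono2) (auto simp: B_def)
  also have "\<dots> \<le> real (2 * Y) * (1 + ln (real (2 * Y)))"
    by (rule sum_card_divisors_le) (use assms in auto)
  also have "\<dots> = real Y / 2 * D" by (simp add: D_def)
  finally have "real (card B) \<le> real Y / 2" using D by (simp only: mult_le_cancel_right_pos)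
  moreover have "card A + card B = Y"
  proof -
    have "card A + card B = card (A \<union> B)"
      by (rule card_Un_disjoint[symmetric]) (auto simp: A_def B_def)
    also have "A \<union> B = {Y<..2*Y}" by (auto simp: A_def B_def)
    finally show ?thesis by simp
  qed
  ultimately have "real Y / 2 \<le> real (card A)" by linarith
  thus ?thesis by (simp only: A_def D_def)
qed

text \<open>
In a list of factors of a product \<open>n\<close> every entry divides \<open>n\<close>, and \<open>n\<close> has at most \<open>D ^ l\<close> divisors;
so \<open>n\<close> arises from at most \<open>D ^ (l * l)\<close> lists. With \<open>D\<close> logarithmic in the size of the factors, hardly
any products are lost to coincidences.
\<close>

lemma card_products_ge:
  fixes G :: "nat set" and l :: nat
  assumes fin: "finite G" and G: "\<And>b. b \<in> G \<Longrightarrow> b > 0 \<and> real (card {k. k dvd b}) \<le> D"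
  shows "real (card G) ^ l \<le> real (card (prod_list ` {bs. set bs \<subseteq> G \<and> length bs = l})) * D ^ (l * l)"
proof -
  define L where "L = {bs. set bs \<subseteq> G \<and> length bs = l}"
  define fiber where "fiber n = {bs \<in> L. prod_list bs = n}" for n
  have finL: "finite L" unfolding L_def by (rule finite_lists_length_eq[OF fin])
  have fiber: "real (card (fiber n)) \<le> D ^ (l * l)" if "n \<in> prod_list ` L" for n
  proof -
    obtain bs where bs: "bs \<in> L" "n = prod_list bs" using \<open>n \<in> prod_list ` L\<close> by blast
    have n: "n > 0" using bs G by (intro Nat.gr0I) (auto simp: L_def prod_list_zero_iff)
    have "fiber n \<subseteq> {bs. set bs \<subseteq> {k. k dvd n} \<and> length bs = l}"
      by (auto simp: fiber_def L_def dest: prod_list_dvd)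
    hence "card (fiber n) \<le> card {bs. set bs \<subseteq> {k. k dvd n} \<and> length bs = l}"
      by (intro card_mono finite_lists_length_eq) (use n in auto)
    also have "\<dots> = card {k. k dvd n} ^ l"
      by (rule card_lists_length_eq) (use n in auto)
    finally have "real (card (fiber n)) \<le> real (card {k. k dvd n}) ^ l"
      by (metis of_nat_le_iff of_nat_power)
    also have "\<dots> \<le> (D ^ length bs) ^ l"
      unfolding bs(2) using bs(1) G by (intro power_mono card_divisors_prod_list_le) (auto simp: L_def)
    also have "\<dots> = D ^ (l * l)" using bs(1) by (simp add: L_def power_mult)
    finally show ?thesis .
  qed
  have "real (card G) ^ l = real (card L)"
    unfolding L_def card_lists_length_eq[OF fin] by simp
  also have "L = (\<Union>n \<in> prod_list ` L. fiber n)" by (auto simp: fiber_def)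
  also have "real (card \<dots>) \<le> real (\<Sum>n \<in> prod_list ` L. card (fiber n))"
    by (intro of_nat_mono card_UN_le finite_imageI finL)
  also have "\<dots> \<le> (\<Sum>n \<in> prod_list ` L. D ^ (l * l))"
    unfolding of_nat_sum by (rule sum_mono) (rule fiber)
  finally show ?thesis by (simp add: L_def)
qed

section \<open>Blocks of coefficients\<close>

text \<open>
Abel's inequality: summation by parts against nonincreasing nonnegative weights.
\<close>

lemma norm_sum_weighted_le:
  fixes w :: "nat \<Rightarrow> real" and f :: "nat \<Rightarrow> 'a :: real_normed_vector"
  assumes dec: "\<And>n. w (Suc n) \<le> w n" and nonneg: "\<And>n. w n \<ge> 0"
    and bound: "\<And>x. x \<le> X \<Longrightarrow> norm (\<Sum>n<x. f n) \<le> C"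
  shows "norm (\<Sum>n<X. w n *\<^sub>R f n) \<le> C * w 0"
proof -
  define F where "F x = (\<Sum>n<x. f n)" for x
  have parts: "(\<Sum>n<x. w n *\<^sub>R f n) = w x *\<^sub>R F x + (\<Sum>n<x. (w n - w (Suc n)) *\<^sub>R F (Suc n))" for x
    by (induction x) (simp_all add: F_def algebra_simps)
  have "norm (\<Sum>n<X. w n *\<^sub>R f n)
      \<le> norm (w X *\<^sub>R F X) + (\<Sum>n<X. norm ((w n - w (Suc n)) *\<^sub>R F (Suc n)))"
    unfolding parts by (rule order_trans[OF norm_triangle_ineq add_left_mono[OF norm_sum]])
  also have "\<dots> \<le> w X * C + (\<Sum>n<X. (w n - w (Suc n)) * C)"
    unfolding F_def
    by (intro add_mono sum_mono)
       (auto intro!: mult_mono bound order_trans[OF norm_ge_zero bound] simp: nonneg dec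
             simp del: sum.lessThan_Suc)
  also have "(\<Sum>n<X. (w n - w (Suc n)) * C) = (w 0 - w X) * C"
    unfolding sum_distrib_right[symmetric] by (simp add: sum_lessThan_telescope')
  finally show ?thesis by (simp add: algebra_simps)
qed

lemma prod_list_between:
  fixes bs :: "nat list"
  assumes "\<And>b. b \<in> set bs \<Longrightarrow> u \<le> b \<and> b \<le> v"
  shows "u ^ length bs \<le> prod_list bs \<and> prod_list bs \<le> v ^ length bs"
  using assms
proof (induction bs)
  case (Cons b bs)
  thus ?case by (auto intro!: mult_le_mono)
qed simp

lemma inverse_of_nat_powr:
  assumes "n > 0"
  shows "1 / (of_nat n powr s :: complex) = (real n powr (- Re s)) *\<^sub>R cis (- Im s * ln (real n))"
proof -
  have "1 / (of_nat n powr s :: complex) = exp (- s * of_real (ln (real n)))"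
    unfolding powr_def using assms by (simp add: exp_minus inverse_eq_divide)
  also have "\<dots> = (exp (- Re s * ln (real n))) *\<^sub>R cis (- Im s * ln (real n))"
    by (subst exp_eq_polar) (simp add: scaleR_conv_of_real)
  finally show ?thesis using assms by (simp add: powr_def)
qed

text \<open>
The two conditions on \<open>Y\<close> needed to build a block from products of \<open>2 * m\<close> factors in \<open>(Y, 2 * Y]\<close>:
the first gives enough products, the second is the final bound for the partial sums of the block.
\<close>

lemma eventually_block_size:
  fixes m :: nat
  shows "eventually (\<lambda>Y::nat. 16 ^ m * (4 * (1 + ln (2 * real Y))) ^ (2 * m * (2 * m)) \<le> (2 * real Y)\<^sup>2) sequentially"
proof -
  have "((\<lambda>Y::nat. 16 ^ m * (4 * (1 + ln (2 * real Y))) ^ (2 * m * (2 * m)) / (2 * real Y)\<^sup>2) \<longlongrightarrow> 0) sequentially"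
    by real_asymp
  hence "eventually (\<lambda>Y::nat. 16 ^ m * (4 * (1 + ln (2 * real Y))) ^ (2 * m * (2 * m)) / (2 * real Y)\<^sup>2 < 1) sequentially"
    by (rule order_tendstoD) simp
  thus ?thesis using eventually_gt_at_top[of 0]
    by eventually_elim (auto simp: field_simps)
qed

lemma eventually_block_bound:
  fixes m :: nat
  assumes "m \<ge> 1"
  shows "eventually (\<lambda>Y::nat. (2 * sqrt (real ((2 * Y) ^ (2 * m) + 1))
           * (3 + real Y * ln (8 * real (2 * m) * real ((2 * Y) ^ (2 * m) + 1))) + 1) / real Y ^ (m + 2)
           \<le> 1 / 2 ^ m) sequentially"
proof -
  define A where "A = ln (32 * real m)"
  have "((\<lambda>Y::nat. (4 * 2 ^ m) * (3 + real Y * (A + real (2 * m) * ln (2 * real Y))) / real Y ^ 2 + 1 / real Y ^ 2) \<longlongrightarrow> 0) sequentially"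
    by real_asymp
  hence "eventually (\<lambda>Y::nat. (4 * 2 ^ m) * (3 + real Y * (A + real (2 * m) * ln (2 * real Y))) / real Y ^ 2 + 1 / real Y ^ 2 < 1 / 2 ^ m) sequentially"
    by (rule order_tendstoD) simp
  thus ?thesis using eventually_gt_at_top[of 0]
  proof eventually_elim
    case (elim Y)
    \<comment> \<open>\<open>X\<close> is replaced by \<open>2 * (2 * Y) ^ (2 * m)\<close>, after which the powers of \<open>Y\<close> cancel.\<close>
    define X where "X = real ((2 * Y) ^ (2 * m) + 1)"
    have "real ((2 * Y) ^ (2 * m)) \<ge> real 1"
      unfolding of_nat_le_iff using elim by (simp add: Suc_le_eq)
    hence X: "1 \<le> X" "X \<le> 2 * (2 * real Y) ^ (2 * m)" by (simp_all add: X_def mult.commute)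
    have "X \<le> (2 * (2 * real Y) ^ m)\<^sup>2"
      using X by (simp add: power_mult_distrib power_even_eq)
    hence sqrt: "sqrt X \<le> 2 * (2 * real Y) ^ m" by (intro real_le_lsqrt) auto
    have "ln (8 * real (2 * m) * X) \<le> ln (8 * real (2 * m) * (2 * (2 * real Y) ^ (2 * m)))"
      by (intro ln_mono mult_left_mono X(2)) (use X assms in auto)
    also have "\<dots> = ln ((32 * real m) * (2 * real Y) ^ (2 * m))" by (simp add: mult_ac)
    also have "\<dots> = A + real (2 * m) * ln (2 * real Y)"
    proof -
      have "ln ((2 * real Y) ^ (2 * m)) = real (2 * m) * ln (2 * real Y)"
        by (rule ln_realpow)
      moreover have "ln ((32 * real m) * (2 * real Y) ^ (2 * m)) = A + ln ((2 * real Y) ^ (2 * m))"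
        unfolding A_def by (rule ln_mult_pos) (use assms elim(2) in auto)
      ultimately show ?thesis by simp
    qed
    finally have ln: "ln (8 * real (2 * m) * X) \<le> A + real (2 * m) * ln (2 * real Y)" .
    have "8 * real (2 * m) * X \<ge> 1 * 1"
      using X assms by (intro mult_mono) auto
    hence ln0: "ln (8 * real (2 * m) * X) \<ge> 0" by simp
    have "2 * sqrt X * (3 + real Y * ln (8 * real (2 * m) * X)) + 1
        \<le> 2 * (2 * (2 * real Y) ^ m) * (3 + real Y * (A + real (2 * m) * ln (2 * real Y))) + 1 * real Y ^ m"
      using X elim ln0 sqrt ln
      by (intro add_mono mult_mono mult_left_mono) (auto intro!: one_le_power)
    also have "\<dots> = ((4 * 2 ^ m) * (3 + real Y * (A + real (2 * m) * ln (2 * real Y))) + 1) * real Y ^ m"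
      by (simp add: power_mult_distrib algebra_simps)
    finally have "(2 * sqrt X * (3 + real Y * ln (8 * real (2 * m) * X)) + 1) / real Y ^ (m + 2)
        \<le> (((4 * 2 ^ m) * (3 + real Y * (A + real (2 * m) * ln (2 * real Y))) + 1) * real Y ^ m) / real Y ^ (m + 2)"
      by (rule divide_right_mono) simp
    also have "\<dots> = (4 * 2 ^ m) * (3 + real Y * (A + real (2 * m) * ln (2 * real Y))) / real Y ^ 2 + 1 / real Y ^ 2"
      using elim(2) by (simp add: power_add add_divide_distrib power2_eq_square)
    finally show ?case using elim(1) by (simp add: X_def)
  qed
qed

text \<open>
A block of quality \<open>m\<close>: coefficients in \<open>{0, 1, -1}\<close>, supported in \<open>(L, N]\<close>, that are numerous enough
for the absolute sum at the exponent \<open>1 - 1 / m\<close> to reach 1, while all partial sums of the Dirichlet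
polynomial are tiny on the whole half-plane \<open>Re s \<ge> 1/2 + 1 / m\<close>.
\<close>

definition dirichlet_block :: "nat \<Rightarrow> nat \<Rightarrow> nat \<Rightarrow> (nat \<Rightarrow> real) \<Rightarrow> bool" where
  "dirichlet_block m L N a \<longleftrightarrow>
     (\<forall>n. a n \<in> {0, 1, -1}) \<and>
     (\<forall>n. a n \<noteq> 0 \<longrightarrow> L < n \<and> n \<le> N) \<and>
     1 \<le> (\<Sum>n\<in>{L<..N}. \<bar>a n\<bar> * real n powr (1 / real m - 1)) \<and>
     (\<forall>x s. 1/2 + 1 / real m \<le> Re s \<longrightarrow>
        norm (dirichlet_partial_sum (\<lambda>n. of_real (a n)) x s) \<le> 1 / 2 ^ m)"

lemma dirichlet_block_exists:
  fixes m L :: nat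
  assumes m: "m \<ge> 1"
  shows "\<exists>N a. L < N \<and> dirichlet_block m L N a"
proof -
  define D where "D Y = 4 * (1 + ln (2 * real Y))" for Y
  have "\<exists>Y. (16 ^ m * D Y ^ (2 * m * (2 * m)) \<le> (2 * real Y)\<^sup>2 \<and>
         (2 * sqrt (real ((2 * Y) ^ (2 * m) + 1))
           * (3 + real Y * ln (8 * real (2 * m) * real ((2 * Y) ^ (2 * m) + 1))) + 1) / real Y ^ (m + 2)
           \<le> 1 / 2 ^ m) \<and> L < Y"
    unfolding D_def
    by (rule eventually_happens'[OF sequentially_bot])
       (intro eventually_conj eventually_block_size eventually_block_bound[OF m] eventually_gt_at_top)
  then obtain Y where Y: "16 ^ m * D Y ^ (2 * m * (2 * m)) \<le> (2 * real Y)\<^sup>2"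
      "(2 * sqrt (real ((2 * Y) ^ (2 * m) + 1))
           * (3 + real Y * ln (8 * real (2 * m) * real ((2 * Y) ^ (2 * m) + 1))) + 1) / real Y ^ (m + 2)
           \<le> 1 / 2 ^ m"
      "L < Y"
    by (elim exE conjE)
  have Y1: "Y \<ge> 1" using Y(3) by simp
  \<comment> \<open>With \<open>l = 2 * m\<close> factors, the loss \<open>N powr (1 / m)\<close> allowed in both estimates is \<open>(2 * Y)\<^sup>2\<close>.\<close>
  define l where "l = 2 * m"
  have l: "l \<ge> 1" using m by (simp add: l_def)
  define M N X where "M = Y ^ l" and "N = (2 * Y) ^ l" and "X = N + 1"
  define G where "G = {b \<in> {Y<..2*Y}. real (card {k. k dvd b}) \<le> D Y}"
  define S where "S = prod_list ` {bs. set bs \<subseteq> G \<and> length bs = l}"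
  have D: "D Y > 0" using Y1 by (auto simp: D_def intro!: add_pos_nonneg)
  have finG: "finite G" by (simp add: G_def)
  have cardG: "card G \<le> Y"
  proof -
    have "card G \<le> card {Y<..2*Y}" by (rule card_mono) (auto simp: G_def)
    thus ?thesis by simp
  qed
  have YM: "Y \<le> M" using l Y1 self_le_power[of Y l] by (simp add: M_def)
  have S: "M \<le> n \<and> n \<le> N" if n: "n \<in> S" for n
  proof -
    obtain bs where bs: "set bs \<subseteq> G" "length bs = l" "n = prod_list bs"
      using n unfolding S_def by blast
    show ?thesis using prod_list_between[of bs Y "2 * Y"] bs
      by (force simp: M_def N_def G_def)
  qed
  have S_pos: "n > 0" "n > L" if "n \<in> S" for n
    using S[OF that] YM Y by auto
  have finS: "finite S"
    using S by (intro finite_subset[of S "{M..N}"]) auto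

  have cardS: "(2 * real Y) ^ l / (2 * real Y)\<^sup>2 \<le> real (card S)"
  proof -
    have "(2 * real Y) ^ l = 16 ^ m * (real Y / 2) ^ l"
    proof -
      have "(16::real) ^ m = 4 ^ l" by (simp add: l_def power_mult)
      moreover have "(2 * real Y) ^ l = (4 * (real Y / 2)) ^ l" by simp
      ultimately show ?thesis by (simp only: power_mult_distrib)
    qed
    also have "\<dots> \<le> 16 ^ m * real (card G) ^ l"
      using card_few_divisors_ge[OF Y1] unfolding G_def D_def
      by (intro mult_left_mono power_mono) auto
    also have "\<dots> \<le> 16 ^ m * (real (card S) * D Y ^ (l * l))"
      unfolding S_def by (intro mult_left_mono card_products_ge finG) (auto simp: G_def)
    also have "\<dots> = real (card S) * (16 ^ m * D Y ^ (2 * m * (2 * m)))"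
      by (simp add: l_def)
    also have "\<dots> \<le> real (card S) * (2 * real Y)\<^sup>2"
      by (intro mult_left_mono Y) auto
    finally show ?thesis using Y1 by (simp add: divide_le_eq)
  qed

  have "\<exists>bs. length bs = l \<and> set bs \<subseteq> G \<and> n = prod_list bs" if "n \<in> S" for n
    using that by (auto simp: S_def)
  moreover have "b > 0" if "b \<in> G" for b using that by (simp add: G_def)
  ultimately obtain e :: "nat \<Rightarrow> real" where e: "\<forall>n. e n \<in> {1, -1}"
    and e_le: "\<forall>x\<le>X. \<forall>t. norm (\<Sum>n<x. if n \<in> S then e n *\<^sub>R cis (t * ln (real n)) else 0)
              \<le> 2 * sqrt (real X) * (3 + real (card G) * ln (8 * real l * real X)) + 1"
    using signs_for_products[of G S l X] finG l X_def by auto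
  define a where "a n = (if n \<in> S then e n else 0)" for n
  have abs_a: "\<bar>a n\<bar> = (if n \<in> S then 1 else 0)" for n
  proof -
    have "e n = 1 \<or> e n = -1" using e by blast
    thus ?thesis by (auto simp: a_def)
  qed

  have lower: "1 \<le> (\<Sum>n\<in>{L<..N}. \<bar>a n\<bar> * real n powr (1 / real m - 1))"
  proof -
    have "1 = (2 * real Y) ^ l / (2 * real Y)\<^sup>2 * real N powr (1 / real m - 1)"
    proof -
      have "real N powr (1 / real m - 1) = (2 * real Y) powr (real l * (1 / real m - 1))"
        using Y1 by (simp add: N_def powr_powr[symmetric] powr_realpow)
      also have "real l * (1 / real m - 1) = 2 - real l"
        using m by (simp add: l_def field_simps)
      also have "(2 * real Y) powr \<dots> = (2 * real Y)\<^sup>2 / (2 * real Y) ^ l"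
        using Y1 by (simp add: powr_diff powr_realpow)
      finally show ?thesis using Y1 by simp
    qed
    also have "\<dots> \<le> real (card S) * real N powr (1 / real m - 1)"
      by (intro mult_right_mono cardS) auto
    also have "\<dots> = (\<Sum>n\<in>S. real N powr (1 / real m - 1))" by simp
    also have "\<dots> \<le> (\<Sum>n\<in>S. \<bar>a n\<bar> * real n powr (1 / real m - 1))"
    proof (rule sum_mono)
      fix n assume n: "n \<in> S"
      have "real N powr (1 / real m - 1) \<le> real n powr (1 / real m - 1)"
        using S[OF n] S_pos[OF n] m by (intro powr_mono2') auto
      thus "real N powr (1 / real m - 1) \<le> \<bar>a n\<bar> * real n powr (1 / real m - 1)"
        using n by (simp add: abs_a)
    qed
    also have "\<dots> \<le> (\<Sum>n\<in>{L<..N}. \<bar>a n\<bar> * real n powr (1 / real m - 1))"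
      using S S_pos by (intro sum_mono2) auto
    finally show ?thesis .
  qed

  have upper: "norm (dirichlet_partial_sum (\<lambda>n. of_real (a n)) x s) \<le> 1 / 2 ^ m"
    if s: "1/2 + 1 / real m \<le> Re s" for x s
  proof -
    define t where "t = - Im s"
    define C where "C = 2 * sqrt (real X) * (3 + real Y * ln (8 * real l * real X)) + 1"
    define f where "f n = (if n \<in> S then e n *\<^sub>R cis (t * ln (real n)) else 0)" for n
    \<comment> \<open>Freezing the weight below \<open>M\<close>, where \<open>f\<close> vanishes, makes it nonincreasing with first value \<open>M powr (- Re s)\<close>.\<close>
    define w where "w n = real (max M n) powr (- Re s)" for n
    have M: "real M \<ge> 1" using YM Y1 by simp
    have s0: "Re s > 0" using s m by (smt (verit) divide_pos_pos of_nat_0_less_iff less_le_trans zero_less_one)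
    have lX: "8 * real l * real X \<ge> 1 * 1"
      using l by (intro mult_mono) (auto simp: X_def)
    have small: "norm (\<Sum>n<y. f n) \<le> C" if "y \<le> X" for y
    proof -
      have "norm (\<Sum>n<y. f n) \<le> 2 * sqrt (real X) * (3 + real (card G) * ln (8 * real l * real X)) + 1"
        using e_le that by (simp add: f_def)
      also have "\<dots> \<le> C"
        unfolding C_def using cardG lX by (intro add_mono mult_left_mono mult_right_mono) auto
      finally show ?thesis .
    qed
    have bound: "norm (\<Sum>n<y. f n) \<le> C" for y
    proof (cases "y \<le> X")
      case False
      have "(\<Sum>n<y. f n) = (\<Sum>n<X. f n)"
        using False by (intro sum.mono_neutral_right) (auto simp: f_def X_def dest: S)
      thus ?thesis using small[of X] by simp
    qed (rule small)
    have "dirichlet_partial_sum (\<lambda>n. of_real (a n)) x s = (\<Sum>n<Suc x. w n *\<^sub>R f n)"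
    proof -
      have "dirichlet_term (\<lambda>n. of_real (a n)) s n = w n *\<^sub>R f n" for n
      proof (cases "n \<in> S")
        case True
        have "dirichlet_term (\<lambda>n. of_real (a n)) s n = of_real (a n) * (1 / (of_nat n powr s))"
          by (simp add: dirichlet_term_def)
        also have "\<dots> = w n *\<^sub>R f n"
          using True S[OF True] S_pos[OF True]
          by (subst inverse_of_nat_powr) (auto simp: f_def w_def a_def t_def max_def scaleR_conv_of_real mult_ac)
        finally show ?thesis .
      qed (simp add: dirichlet_term_def a_def f_def)
      moreover have "f 0 = 0" using S_pos[of 0] by (auto simp: f_def)
      ultimately show ?thesis
        by (simp add: dirichlet_partial_sum_def sum.atLeast1_atMost_eq sum.lessThan_Suc_shift del: sum.lessThan_Suc)
    qed
    also have "norm \<dots> \<le> C * w 0"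
    proof (rule norm_sum_weighted_le)
      show "w (Suc n) \<le> w n" for n
        unfolding w_def using s0 M by (intro powr_mono2') auto
    qed (auto simp: w_def bound)
    also have "\<dots> \<le> C * real M powr (- (1/2 + 1 / real m))"
    proof (intro mult_left_mono)
      show "w 0 \<le> real M powr (- (1/2 + 1 / real m))"
        unfolding w_def using s M by (auto intro!: powr_mono)
      show "C \<ge> 0" using bound[of 0] by simp
    qed
    also have "real M powr (- (1/2 + 1 / real m)) = 1 / real Y ^ (m + 2)"
    proof -
      have "real M powr (- (1/2 + 1 / real m)) = real Y powr (real l * - (1/2 + 1 / real m))"
        using Y1 by (simp add: M_def powr_powr[symmetric] powr_realpow)
      also have "real l * - (1/2 + 1 / real m) = - real (m + 2)"
        using m by (simp add: l_def field_simps)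
      also have "real Y powr \<dots> = 1 / real Y ^ (m + 2)"
        using Y1 by (subst powr_minus, subst powr_realpow) (auto simp: divide_inverse)
      finally show ?thesis .
    qed
    also have "C * (1 / real Y ^ (m + 2)) \<le> 1 / 2 ^ m"
      using Y(2) by (simp add: C_def X_def N_def l_def)
    finally show ?thesis .
  qed

  have "N > L"
  proof -
    have "M \<le> N" unfolding M_def N_def by (intro power_mono) auto
    thus ?thesis using YM Y by simp
  qed
  moreover have "a n \<in> {0, 1, -1}" for n using e by (simp add: a_def)
  moreover have "L < n \<and> n \<le> N" if "a n \<noteq> 0" for n
    using that S[of n] S_pos[of n] by (auto simp: a_def split: if_splits)
  ultimately show ?thesis using lower upper unfolding dirichlet_block_def by blast
qed

section \<open>Concatenation of the blocks\<close>

theorem mainTheorem1: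
  shows "\<exists>a :: nat \<Rightarrow> complex.
    (\<forall>n\<ge>1. a n \<in> {0, 1, -1}) \<and>
    (\<forall>\<delta>::real. \<delta> > 0 \<longrightarrow>
       uniformly_convergent_on {s. Re s \<ge> \<delta> + 1/2} (dirichlet_partial_sum a)) \<and>
    (\<forall>s. Re s < 1 \<longrightarrow> \<not> summable (\<lambda>n. norm (dirichlet_term a s (Suc n))))"
proof -
  have "\<forall>k L. \<exists>N a. L < N \<and> dirichlet_block (Suc k) L N a"
    using dirichlet_block_exists by simp
  then obtain nxt :: "nat \<Rightarrow> nat \<Rightarrow> nat" and blk :: "nat \<Rightarrow> nat \<Rightarrow> nat \<Rightarrow> real"
    where nxt: "\<And>k L. L < nxt k L" and blk: "\<And>k L. dirichlet_block (Suc k) L (nxt k L) (blk k L)"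
    by metis
  define E where "E = rec_nat 0 nxt"
  define c where "c k = blk k (E k)" for k
  have E_Suc: "E (Suc k) = nxt k (E k)" for k by (simp add: E_def)
  have E_mono: "strict_mono E" using nxt by (intro strict_monoI_Suc) (simp add: E_Suc)
  have block: "dirichlet_block (Suc k) (E k) (E (Suc k)) (c k)" for k
    unfolding c_def E_Suc by (rule blk)
  have c_range: "c k n \<in> {0, 1, -1}" for k n
    using block unfolding dirichlet_block_def by blast
  have c_supp: "E k < n" "n \<le> E (Suc k)" if "c k n \<noteq> 0" for k n
    using block that unfolding dirichlet_block_def by blast+
  have c_lower: "1 \<le> (\<Sum>n\<in>{E k<..E (Suc k)}. \<bar>c k n\<bar> * real n powr (1 / real (Suc k) - 1))" for k
    using block unfolding dirichlet_block_def by blast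
  have c_upper: "norm (dirichlet_partial_sum (\<lambda>n. of_real (c k n)) x s) \<le> 1 / 2 ^ Suc k"
    if "1/2 + 1 / real (Suc k) \<le> Re s" for k x s
    using block that unfolding dirichlet_block_def by blast
  have c_less: "k < n" if "c k n \<noteq> 0" for k n
    using c_supp(1)[OF that] strict_mono_imp_increasing[OF E_mono, of k] by linarith

  define ar where "ar n = (\<Sum>k<n. c k n)" for n
  define a where "a n = complex_of_real (ar n)" for n
  \<comment> \<open>Block \<open>k\<close> lies beyond \<open>E k \<ge> k\<close>, so blocks with \<open>k \<ge> n\<close> do not reach \<open>n\<close>.\<close>
  have ar_eq: "ar n = (\<Sum>k<K. c k n)" if "n \<le> K" for n K
  proof -
    have "c k n = 0" if "\<not> k < n" for k using c_less[of k n] that by blast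
    thus ?thesis unfolding ar_def using \<open>n \<le> K\<close> by (intro sum.mono_neutral_left) auto
  qed
  have ar_block: "ar n = c k n" if "n \<in> {E k<..E (Suc k)}" for n k
  proof -
    have "c j n = 0" if "j \<noteq> k" for j
    proof (rule ccontr)
      assume "c j n \<noteq> 0"
      hence "E j < n" "n \<le> E (Suc j)" by (rule c_supp)+
      hence "E j < E (Suc k)" "E k < E (Suc j)"
        using \<open>n \<in> {E k<..E (Suc k)}\<close> by auto
      hence "j < Suc k" "k < Suc j" using E_mono by (simp_all only: strict_mono_less)
      thus False using that by simp
    qed
    hence "(\<Sum>j<Suc (n + k). c j n) = (\<Sum>j\<in>{k}. c j n)"
      by (intro sum.mono_neutral_right) auto
    thus ?thesis using ar_eq[of n "Suc (n + k)"] by simp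
  qed
  have range: "a n \<in> {0, 1, -1}" for n
  proof (cases "\<exists>k. c k n \<noteq> 0")
    case True
    then obtain k where "c k n \<noteq> 0" by blast
    hence "ar n = c k n" using c_supp by (intro ar_block) auto
    thus ?thesis using c_range[of k n] by (auto simp: a_def)
  qed (simp add: a_def ar_def)

  define g where "g k x s = dirichlet_partial_sum (\<lambda>n. of_real (c k n)) x s" for k x s
  have split: "dirichlet_partial_sum a x s = (\<Sum>k<K. g k x s)" if "x \<le> K" for x s K
  proof -
    have "dirichlet_partial_sum a x s = (\<Sum>n=1..x. \<Sum>k<K. dirichlet_term (\<lambda>n. of_real (c k n)) s n)"
      unfolding dirichlet_partial_sum_def
    proof (intro sum.cong refl)
      fix n assume "n \<in> {1..x}"
      hence "ar n = (\<Sum>k<K. c k n)" using that by (intro ar_eq) simp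
      thus "dirichlet_term a s n = (\<Sum>k<K. dirichlet_term (\<lambda>n. of_real (c k n)) s n)"
        by (simp add: dirichlet_term_def a_def sum_divide_distrib)
    qed
    also have "\<dots> = (\<Sum>k<K. g k x s)"
      unfolding g_def dirichlet_partial_sum_def by (rule sum.swap)
    finally show ?thesis .
  qed
  have g_const: "g k x s = g k (E (Suc k)) s" if "x \<ge> E (Suc k)" for k x s
    unfolding g_def dirichlet_partial_sum_def using that c_supp(2)[of k]
    by (intro sum.mono_neutral_right) (force simp: dirichlet_term_def)+

  have "uniformly_convergent_on {s. Re s \<ge> \<delta> + 1/2} (dirichlet_partial_sum a)"
    if \<delta>: "\<delta> > 0" for \<delta> :: real
  proof (rule Cauchy_uniformly_convergent, unfold uniformly_Cauchy_on_def, intro allI impI)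
    fix \<epsilon> :: real assume \<epsilon>: "\<epsilon> > 0"
    have "eventually (\<lambda>K. 1 / real (Suc K) < \<delta>) sequentially"
      by (rule order_tendstoD[OF lim_1_over_n[THEN LIMSEQ_Suc]]) (use \<delta> in auto)
    moreover have "eventually (\<lambda>K. 2 * (1 / 2 :: real) ^ K < \<epsilon>) sequentially"
      by (rule order_tendstoD[OF tendsto_mult_right_zero[OF LIMSEQ_power_zero]]) (use \<epsilon> in auto)
    ultimately have "eventually (\<lambda>K. 1 / real (Suc K) < \<delta> \<and> 2 * (1 / 2 :: real) ^ K < \<epsilon>) sequentially"
      by (rule eventually_conj)
    then obtain K where K: "1 / real (Suc K) < \<delta>" "2 * (1 / 2 :: real) ^ K < \<epsilon>"
      using eventually_happens'[OF sequentially_bot] by blast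
    have "dist (dirichlet_partial_sum a x s) (dirichlet_partial_sum a y s) < \<epsilon>"
      if s: "s \<in> {s. Re s \<ge> \<delta> + 1/2}" and xy: "x \<ge> E K" "y \<ge> E K" for x y s
    proof -
      define K' where "K' = max x y + K"
      have "dirichlet_partial_sum a x s - dirichlet_partial_sum a y s = (\<Sum>k<K'. g k x s - g k y s)"
        by (simp add: split[of x K'] split[of y K'] K'_def sum_subtractf)
      also have "\<dots> = (\<Sum>k\<in>{K..<K'}. g k x s - g k y s)"
      proof (intro sum.mono_neutral_right ballI)
        fix k assume "k \<in> {..<K'} - {K..<K'}"
        hence "Suc k \<le> K" by auto
        hence "E (Suc k) \<le> E K" using strict_mono_less_eq[OF E_mono] by blast
        thus "g k x s - g k y s = 0" using xy g_const[of k x s] g_const[of k y s] by simp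
      qed auto
      also have "norm \<dots> \<le> (\<Sum>k\<in>{K..<K'}. (1 / 2) ^ k)"
      proof (rule sum_norm_le)
        fix k assume k: "k \<in> {K..<K'}"
        have "1 / real (Suc k) \<le> 1 / real (Suc K)" using k by (intro divide_left_mono) auto
        hence "1/2 + 1 / real (Suc k) \<le> Re s" using K(1) s by simp
        hence "norm (g k x s) \<le> 1 / 2 ^ Suc k" "norm (g k y s) \<le> 1 / 2 ^ Suc k"
          unfolding g_def by (rule c_upper)+
        hence "norm (g k x s - g k y s) \<le> 1 / 2 ^ Suc k + 1 / 2 ^ Suc k"
          by (intro order_trans[OF norm_triangle_ineq4] add_mono)
        thus "norm (g k x s - g k y s) \<le> (1 / 2) ^ k" by (simp add: power_one_over)
      qed
      also have "\<dots> \<le> 2 * (1 / 2) ^ K"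
      proof -
        have "(\<Sum>k\<in>{K..<K + j}. (1 / 2 :: real) ^ k) = 2 * (1 / 2) ^ K - 2 * (1 / 2) ^ (K + j)" for j
          by (induction j) simp_all
        from this[of "max x y"] show ?thesis by (simp add: K'_def add.commute)
      qed
      finally show ?thesis using K(2) by (simp add: dist_norm)
    qed
    thus "\<exists>M. \<forall>s\<in>{s. Re s \<ge> \<delta> + 1/2}. \<forall>m\<ge>M. \<forall>n\<ge>M.
            dist (dirichlet_partial_sum a m s) (dirichlet_partial_sum a n s) < \<epsilon>"
      by (intro exI[of _ "E K"]) blast
  qed

  moreover have "\<not> summable (\<lambda>n. norm (dirichlet_term a s (Suc n)))" if s: "Re s < 1" for s
  proof
    assume "summable (\<lambda>n. norm (dirichlet_term a s (Suc n)))"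
    then obtain M where M: "\<And>m n. m \<ge> M \<Longrightarrow> norm (\<Sum>i=m..<n. norm (dirichlet_term a s (Suc i))) < 1"
      unfolding summable_Cauchy using zero_less_one by blast
    have "eventually (\<lambda>k. 1 / real (Suc k) < 1 - Re s) sequentially"
      by (rule order_tendstoD[OF lim_1_over_n[THEN LIMSEQ_Suc]]) (use s in auto)
    hence "eventually (\<lambda>k. 1 / real (Suc k) < 1 - Re s \<and> M \<le> k) sequentially"
      by (intro eventually_conj eventually_ge_at_top)
    then obtain k where k: "1 / real (Suc k) < 1 - Re s" "M \<le> k"
      using eventually_happens'[OF sequentially_bot] by blast
    have "1 \<le> (\<Sum>n\<in>{E k<..E (Suc k)}. \<bar>c k n\<bar> * real n powr (1 / real (Suc k) - 1))"
      by (rule c_lower)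
    also have "\<dots> \<le> (\<Sum>n\<in>{E k<..E (Suc k)}. norm (dirichlet_term a s n))"
    proof (rule sum_mono)
      fix n assume n: "n \<in> {E k<..E (Suc k)}"
      have "real n powr (1 / real (Suc k) - 1) \<le> real n powr (- Re s)"
        using k n by (intro powr_mono) auto
      moreover have "norm (dirichlet_term a s n) = \<bar>c k n\<bar> * real n powr (- Re s)"
      proof -
        have "dirichlet_term a s n = of_real (c k n) * (1 / (of_nat n powr s))"
          using n by (simp add: dirichlet_term_def a_def ar_block)
        also have "norm \<dots> = \<bar>c k n\<bar> * real n powr (- Re s)"
          using n by (subst inverse_of_nat_powr) (auto simp: norm_mult)
        finally show ?thesis .
      qed
      ultimately show "\<bar>c k n\<bar> * real n powr (1 / real (Suc k) - 1) \<le> norm (dirichlet_term a s n)"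
        by (simp add: mult_left_mono)
    qed
    also have "\<dots> = (\<Sum>i=E k..<E (Suc k). norm (dirichlet_term a s (Suc i)))"
      by (rule sum.reindex_bij_witness[of _ Suc "\<lambda>n. n - 1"]) auto
    also have "\<dots> < 1"
      using M[of "E k" "E (Suc k)"] k(2) strict_mono_imp_increasing[OF E_mono, of k] by simp
    finally show False by simp
  qed
  ultimately show ?thesis by (intro exI[of _ a] conjI allI impI range)
qed

end
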